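(* Let $X$ be a compact metric space and let $f\colon X\to X$ be a continuous map with $X=Sh(f)$ (every point of $X$ is shadowable for $f$). Then the following conditions are equivalent: (a) $X=LSC(\omega_f)$, i.e. the set-valued map $\omega_f$ is lower semicontinuous at every point of $X$; (b) $X=CC(f)$, i.e. $f$ is chain continuous at every point of $X$.
   Context: $(X,d)$ is a compact metric space, $f\colon X\to X$ is continuous, and $\mathcal{K}(X)$ is the set of non-empty closed subsets of $X$. $\omega_f(x)$ is the set of $y\in X$ such that $\lim_{j\to\infty}f^{i_j}(x)=y$ for some $0\le i_1<i_2<\cdots$; $\omega_f$ is regarded as a map $X\to\mathcal{K}(X)$. A map $\phi\colon X\to\mathcal{K}(X)$ is lower semicontinuous at $x$ if for every open $U\subset X$ with $\phi(x)\cap U\ne\emptyset$ there is $\delta>0$ such that $d(x,y)\le\delta$ implies $\phi(y)\cap U\ne\emptyset$ for all $y\in X$. $LSC(\phi)$ is the set of lower semicontinuity points of $\phi$. For $\delta>0$, a sequence $(x_i)_{i\ge0}$ in $X$ is a $\delta$-pseudo orbit of $f$ if $\sup_{i\ge0}d(f(x_i),x_{i+1})\le\delta$; it is $\epsilon$-shadowed by $y\in X$ if $\sup_{i\ge0}d(x_i,f^i(y))\le\epsilon$. A point $x\in X$ is shadowable for $f$ if for every $\epsilon>0$ there is $\delta>0$ such that every $\delta$-pseudo orbit $(x_i)_{i\ge0}$ of $f$ with $x_0=x$ is $\epsilon$-shadowed by some $y\in X$; $Sh(f)$ is the set of shadowable points. $f$ is chain continuous at $x$ if for every $\epsilon>0$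 there is $\delta>0$ such that every $\delta$-pseudo orbit $(x_i)_{i\ge0}$ of $f$ with $x_0=x$ satisfies $\sup_{i\ge0}d(x_i,f^i(x))\le\epsilon$; $CC(f)$ is the set of chain continuity points. *)

theory Defs
  imports "HOL-Analysis.Analysis"
begin

text \<open>
  A compact metric space is a compact carrier set \<open>X\<close> in a type of class
  \<open>metric_space\<close>, with the metric \<open>dist\<close> restricted to \<open>X\<close>; a self-map of \<open>X\<close> is a function
  \<open>f\<close> with \<open>f \<in> X \<rightarrow> X\<close>, and all notions are relative to \<open>X\<close>.
  A bound \<open>sup\<^sub>i a\<^sub>i \<le> c\<close> is written as \<open>\<forall>i. a\<^sub>i \<le> c\<close>.
\<close>

definition omega_limit :: "'a::metric_space set \<Rightarrow> ('a \<Rightarrow> 'a) \<Rightarrow> 'a \<Rightarrow> 'a set" where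
  "omega_limit X f x =
     {y \<in> X. \<exists>i :: nat \<Rightarrow> nat. strict_mono i \<and> (\<lambda>j. (f ^^ i j) x) \<longlonglongrightarrow> y}"

definition lsc_at :: "'a::metric_space set \<Rightarrow> ('a \<Rightarrow> 'a set) \<Rightarrow> 'a \<Rightarrow> bool" where
  "lsc_at X \<phi> x \<longleftrightarrow>
     (\<forall>U. openin (top_of_set X) U \<and> \<phi> x \<inter> U \<noteq> {} \<longrightarrow>
        (\<exists>\<delta>>0. \<forall>y\<in>X. dist x y \<le> \<delta> \<longrightarrow> \<phi> y \<inter> U \<noteq> {}))"

definition LSC :: "'a::metric_space set \<Rightarrow> ('a \<Rightarrow> 'a set) \<Rightarrow> 'a set" where
  "LSC X \<phi> = {x \<in> X. lsc_at X \<phi> x}"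

definition pseudo_orbit ::
    "'a::metric_space set \<Rightarrow> ('a \<Rightarrow> 'a) \<Rightarrow> real \<Rightarrow> (nat \<Rightarrow> 'a) \<Rightarrow> bool" where
  "pseudo_orbit X f \<delta> s \<longleftrightarrow>
     (\<forall>i. s i \<in> X) \<and> (\<forall>i. dist (f (s i)) (s (Suc i)) \<le> \<delta>)"

definition shadowed_by ::
    "('a::metric_space \<Rightarrow> 'a) \<Rightarrow> real \<Rightarrow> (nat \<Rightarrow> 'a) \<Rightarrow> 'a \<Rightarrow> bool" where
  "shadowed_by f \<epsilon> s y \<longleftrightarrow> (\<forall>i. dist (s i) ((f ^^ i) y) \<le> \<epsilon>)"

definition shadowable_at :: "'a::metric_space set \<Rightarrow> ('a \<Rightarrow> 'a) \<Rightarrow> 'a \<Rightarrow> bool" where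
  "shadowable_at X f x \<longleftrightarrow>
     (\<forall>\<epsilon>>0. \<exists>\<delta>>0. \<forall>s. pseudo_orbit X f \<delta> s \<and> s 0 = x \<longrightarrow>
        (\<exists>y\<in>X. shadowed_by f \<epsilon> s y))"

definition Sh :: "'a::metric_space set \<Rightarrow> ('a \<Rightarrow> 'a) \<Rightarrow> 'a set" where
  "Sh X f = {x \<in> X. shadowable_at X f x}"

definition chain_continuous_at :: "'a::metric_space set \<Rightarrow> ('a \<Rightarrow> 'a) \<Rightarrow> 'a \<Rightarrow> bool" where
  "chain_continuous_at X f x \<longleftrightarrow>
     (\<forall>\<epsilon>>0. \<exists>\<delta>>0. \<forall>s. pseudo_orbit X f \<delta> s \<and> s 0 = x \<longrightarrow>
        (\<forall>i. dist (s i) ((f ^^ i) x) \<le> \<epsilon>))"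

definition CC :: "'a::metric_space set \<Rightarrow> ('a \<Rightarrow> 'a) \<Rightarrow> 'a set" where
  "CC X f = {x \<in> X. chain_continuous_at X f x}"

end

theory Submission imports Defs begin

text \<open>
  Chain continuity at \<open>x\<close> makes the orbits of \<open>x\<close> and of any nearby \<open>y\<close> stay close
  forever, which gives lower semicontinuity of the limit set.

  Conversely, assume shadowing and lower semicontinuity. If \<open>v\<close> is chain reachable from \<open>x\<close>,
  then shadowing a chain from \<open>x\<close> to \<open>v\<close> followed by the orbit of \<open>v\<close> gives points near \<open>x\<close>
  whose limit sets are close to that of \<open>v\<close>, so the limit set of \<open>x\<close> is contained in that of
  \<open>v\<close>. Hence all points of limit sets are recurrent, under \<open>f\<close> and so under every
  power of \<open>f\<close>. If a recurrent point \<open>u\<close> were not a chain continuity point, there would be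
  chains of equal length from \<open>u\<close> to two points \<open>v\<close>, \<open>w\<close> that are far apart, and both can be
  completed to loops \<open>B\<close>, \<open>A\<close> at \<open>u\<close>. The loops \<open>BA\<close> and \<open>AB\<close> have the same
  length \<open>L\<close>. Shadowing a concatenation of copies of \<open>AB\<close> with isolated copies of \<open>BA\<close> at
  growing gaps yields a limit point which follows \<open>BA\<close> once and \<open>AB\<close> ever after, so it is
  not recurrent under \<open>f\<^sup>L\<close>. Finally, chain continuity at a point of the limit set of \<open>x\<close>
  pulls back to \<open>x\<close>.
\<close>

section \<open>Finite chains and their concatenation\<close>

definition chain :: "'a::metric_space set \<Rightarrow> ('a \<Rightarrow> 'a) \<Rightarrow> real \<Rightarrow> nat \<Rightarrow> (nat \<Rightarrow> 'a) \<Rightarrow> bool" where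
  "chain X f \<delta> n s \<longleftrightarrow>
     (\<forall>i\<le>n. s i \<in> X) \<and> (\<forall>i<n. dist (f (s i)) (s (Suc i)) \<le> \<delta>)"

definition chain_reachable :: "'a::metric_space set \<Rightarrow> ('a \<Rightarrow> 'a) \<Rightarrow> 'a \<Rightarrow> 'a \<Rightarrow> bool" where
  "chain_reachable X f x v \<longleftrightarrow> (\<forall>\<delta>>0. \<exists>n s. chain X f \<delta> n s \<and> s 0 = x \<and> s n = v)"

lemma chain_append:
  assumes s: "chain X f \<delta> n s" and t: "chain X f \<delta> m t" and eq: "s n = t 0"
  obtains r where "chain X f \<delta> (n + m) r" "\<And>i. i \<le> n \<Longrightarrow> r i = s i" "\<And>i. r (n + i) = t i"
proof
  let ?r = "\<lambda>i. if i < n then s i else t (i - n)"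
  show left: "?r i = s i" if "i \<le> n" for i
    using that eq by (cases "i = n") auto
  show "?r (n + i) = t i" for i by simp
  have "dist (f (?r i)) (?r (Suc i)) \<le> \<delta>" if "i < n + m" for i
  proof (cases "i < n")
    case True
    then have "?r i = s i" "?r (Suc i) = s (Suc i)" using left[of "Suc i"] by auto
    then show ?thesis using s True by (simp add: chain_def)
  next
    case False
    then have "Suc i - n = Suc (i - n)" "i - n < m" using that by auto
    then show ?thesis using t False by (simp add: chain_def)
  qed
  moreover have "?r i \<in> X" if "i \<le> n + m" for i
    using that s t by (auto simp: chain_def)
  ultimately show "chain X f \<delta> (n + m) ?r"
    by (auto simp: chain_def)
qed

text \<open>The endpoint enters only the last error, so the triangle inequality charges the
  displacement to that step. This makes chains end exactly at a prescribed limit point.\<close>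

lemma chain_move_end:
  assumes s: "chain X f \<delta> n s" and v: "v \<in> X" "dist (s n) v \<le> \<delta>'" and n: "n > 0"
  shows "chain X f (\<delta> + \<delta>') n (s(n := v))"
proof -
  have "0 \<le> \<delta>'" using v(2) zero_le_dist order_trans by blast
  have "dist (f (s i)) ((s(n := v)) (Suc i)) \<le> \<delta> + \<delta>'" if "i < n" for i
  proof (cases "Suc i = n")
    case True
    have "dist (f (s i)) v \<le> dist (f (s i)) (s n) + dist (s n) v" by (rule dist_triangle)
    moreover have "dist (f (s i)) (s n) \<le> \<delta>" using s True by (auto simp: chain_def)
    ultimately show ?thesis using True v(2) by auto
  next
    case False
    then have "dist (f (s i)) (s (Suc i)) \<le> \<delta>" using s that by (auto simp: chain_def)
    then show ?thesis using False \<open>0 \<le> \<delta>'\<close> by simp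
  qed
  then show ?thesis using s v(1) by (auto simp: chain_def)
qed

lemma pseudo_orbit_imp_chain: "pseudo_orbit X f \<delta> s \<Longrightarrow> chain X f \<delta> n s"
  by (simp add: pseudo_orbit_def chain_def)

lemma pseudo_orbit_shift: "pseudo_orbit X f \<delta> s \<Longrightarrow> pseudo_orbit X f \<delta> (\<lambda>i. s (n + i))"
  by (simp add: pseudo_orbit_def)

lemma pseudo_orbit_mono: "pseudo_orbit X f \<delta> s \<Longrightarrow> \<delta> \<le> \<delta>' \<Longrightarrow> pseudo_orbit X f \<delta>' s"
  unfolding pseudo_orbit_def by (meson order_trans)

lemma chain_mono: "chain X f \<delta> n s \<Longrightarrow> \<delta> \<le> \<delta>' \<Longrightarrow> chain X f \<delta>' n s"
  unfolding chain_def by (meson order_trans)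

lemma pseudo_orbit_loops:
  fixes L :: nat
  assumes L: "L > 0"
    and chains: "\<And>k. chain X f \<delta> L (g k)"
    and ends: "\<And>k. g k 0 = u" "\<And>k. g k L = u"
  shows "pseudo_orbit X f \<delta> (\<lambda>n. g (n div L) (n mod L))"
proof -
  have "dist (f (g (n div L) (n mod L))) (g (Suc n div L) (Suc n mod L)) \<le> \<delta>" for n
  proof (cases "Suc (n mod L) = L")
    case True
    \<comment> \<open>The next index opens a new block at offset 0; its value \<open>u\<close> is
      also the value of the old block at offset \<open>L\<close>.\<close>
    then have "g (Suc n div L) (Suc n mod L) = g (n div L) (Suc (n mod L))"
      using ends by (simp add: mod_Suc)
    then show ?thesis using chains[of "n div L"] L by (simp add: chain_def)
  next
    case False
    then have "g (Suc n div L) (Suc n mod L) = g (n div L) (Suc (n mod L))"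
      by (simp add: mod_Suc div_Suc)
    then show ?thesis using chains[of "n div L"] L by (simp add: chain_def)
  qed
  moreover have "g (n div L) (n mod L) \<in> X" for n
    using chains[of "n div L"] L by (simp add: chain_def less_imp_le)
  ultimately show ?thesis by (simp add: pseudo_orbit_def)
qed

section \<open>Limit sets through late close visits\<close>

lemma omega_limit_iff:
  "y \<in> omega_limit X f x \<longleftrightarrow> y \<in> X \<and> (\<forall>e>0. \<forall>N. \<exists>n\<ge>N. dist ((f ^^ n) x) y < e)"
  (is "_ \<longleftrightarrow> _ \<and> ?R")
proof
  assume "y \<in> omega_limit X f x"
  then obtain i :: "nat \<Rightarrow> nat" where y: "y \<in> X" and i: "strict_mono i"
    and lim: "(\<lambda>j. (f ^^ i j) x) \<longlonglongrightarrow> y"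
    by (auto simp: omega_limit_def)
  have "\<exists>n\<ge>N. dist ((f ^^ n) x) y < e" if e: "e > 0" for e :: real and N
  proof -
    obtain J where J: "\<And>j. j \<ge> J \<Longrightarrow> dist ((f ^^ i j) x) y < e"
      using lim e by (auto simp: lim_sequentially)
    have "N \<le> i (max J N)" using seq_suble[OF i, of "max J N"] by linarith
    then show ?thesis using J[of "max J N"] by auto
  qed
  with y show "y \<in> X \<and> ?R" by blast
next
  assume R: "y \<in> X \<and> ?R"
  have "\<exists>i. \<forall>j. dist ((f ^^ i j) x) y < 1 / real (Suc j) \<and> i j < i (Suc j)"
  proof (rule dependent_nat_choice)
    show "\<exists>n. dist ((f ^^ n) x) y < 1 / real (Suc 0)"
      using R[THEN conjunct2, rule_format, of 1 0] by auto
    show "\<exists>m. dist ((f ^^ m) x) y < 1 / real (Suc (Suc j)) \<and> n < m" for n j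
      using R[THEN conjunct2, rule_format, of "1 / real (Suc (Suc j))" "Suc n"] by auto
  qed
  then obtain i where d: "\<And>j. dist ((f ^^ i j) x) y < 1 / real (Suc j)"
    and "\<And>j. i j < i (Suc j)" by blast
  then have "strict_mono i" by (simp add: strict_mono_Suc_iff)
  moreover have "(\<lambda>j. (f ^^ i j) x) \<longlonglongrightarrow> y"
  proof (rule metric_tendsto_imp_tendsto)
    show "(\<lambda>j. 1 / real (Suc j)) \<longlonglongrightarrow> 0"
      by (rule LIMSEQ_Suc[OF lim_1_over_n])
    show "\<forall>\<^sub>F j in sequentially. dist ((f ^^ i j) x) y \<le> dist (1 / real (Suc j)) 0"
      using d by (intro always_eventually) (auto intro: less_imp_le)
  qed
  ultimately show "y \<in> omega_limit X f x"
    using R by (auto simp: omega_limit_def)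
qed

text \<open>The sum lies strictly between consecutive powers of two. This identifies the blocks
  following a marked one in \<open>shadowed_loops_close\<close>.\<close>

lemma power_of_two_plus_neq:
  fixes k j :: nat
  assumes "0 < k" "k < 2 ^ j"
  shows "2 ^ j + k \<noteq> 2 ^ l"
proof
  assume eq: "2 ^ j + k = (2::nat) ^ l"
  have "(2::nat) ^ j < 2 ^ l" "(2::nat) ^ l < 2 ^ Suc j"
    using assms eq unfolding power_Suc by linarith+
  then have "j < l \<and> l < Suc j"
    by (metis power_strict_increasing_iff one_less_numeral_iff semiring_norm(76))
  then show False by linarith
qed

section \<open>Iterates of a continuous self-map of a compact space\<close>

locale compact_system =
  fixes X :: "'a::metric_space set" and f :: "'a \<Rightarrow> 'a"
  assumes compact: "compact X"
    and maps: "f \<in> X \<rightarrow> X"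
    and cont: "continuous_on X f"
begin

lemma iterate_in: "x \<in> X \<Longrightarrow> (f ^^ n) x \<in> X"
  using maps by (induction n) auto

lemma iterate_cont: "continuous_on X (f ^^ n)"
proof (induction n)
  case (Suc n)
  have "continuous_on X (f \<circ> (f ^^ n))"
    using iterate_in by (intro continuous_on_compose Suc continuous_on_subset[OF cont]) blast
  then show ?case by simp
qed (simp add: id_def)

lemma orbit_pseudo_orbit: "x \<in> X \<Longrightarrow> 0 \<le> \<delta> \<Longrightarrow> pseudo_orbit X f \<delta> (\<lambda>i. (f ^^ i) x)"
  by (simp add: pseudo_orbit_def iterate_in)

lemma convergent_subsequence:
  assumes "\<And>n :: nat. s n \<in> X"
  obtains l r where "l \<in> X" "strict_mono (r :: nat \<Rightarrow> nat)" "(\<lambda>n. s (r n)) \<longlonglongrightarrow> l"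
  using seq_compactE[OF compact_imp_seq_compact[OF compact], of s] assms
  by (auto simp: o_def)

lemma omega_limit_nonempty:
  assumes "x \<in> X" shows "omega_limit X f x \<noteq> {}"
proof -
  obtain l r where "l \<in> X" "strict_mono (r :: nat \<Rightarrow> nat)" "(\<lambda>n. (f ^^ r n) x) \<longlonglongrightarrow> l"
    by (rule convergent_subsequence[of "\<lambda>n. (f ^^ n) x"]) (use iterate_in[OF assms] in auto)
  then show ?thesis by (auto simp: omega_limit_def)
qed

section \<open>Chain reachability and inclusion of limit sets\<close>

lemma chain_reachable_omega_limit:
  assumes u: "u \<in> omega_limit X f x" and x: "x \<in> X"
  shows "chain_reachable X f x u"
  unfolding chain_reachable_def
proof (intro allI impI)
  fix \<delta> :: real assume "\<delta> > 0"
  \<comment> \<open>\<open>n \<ge> 1\<close> lets \<open>u\<close> overwrite the end of the orbit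
    segment without touching its start \<open>x\<close>.\<close>
  then obtain n where n: "n \<ge> 1" "dist ((f ^^ n) x) u < \<delta>"
    using u by (auto simp: omega_limit_iff)
  have "chain X f (0 + \<delta>) n ((\<lambda>i. (f ^^ i) x)(n := u))"
    using n u x
    by (intro chain_move_end pseudo_orbit_imp_chain orbit_pseudo_orbit) (auto simp: omega_limit_iff)
  then show "\<exists>n s. chain X f \<delta> n s \<and> s 0 = x \<and> s n = u"
    using n by (intro exI[of _ n] exI[of _ "(\<lambda>i. (f ^^ i) x)(n := u)"]) auto
qed

lemma omega_limit_subset_of_chain_reachable:
  assumes x: "x \<in> X" and sh: "shadowable_at X f x" and lsc: "lsc_at X (omega_limit X f) x"
    and reach: "chain_reachable X f x v"
  shows "omega_limit X f x \<subseteq> omega_limit X f v"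
proof
  fix p assume p: "p \<in> omega_limit X f x"
  then have pX: "p \<in> X" by (simp add: omega_limit_iff)
  have "\<exists>m\<ge>N. dist ((f ^^ m) v) p < e" if e: "e > 0" for e :: real and N
  proof -
    let ?U = "X \<inter> ball p (e/2)"
    have "openin (top_of_set X) ?U" "omega_limit X f x \<inter> ?U \<noteq> {}"
      using p pX e by (auto intro: openin_open_Int)
    then obtain \<delta>0 where \<delta>0: "\<delta>0 > 0"
      and low: "\<And>y. y \<in> X \<Longrightarrow> dist x y \<le> \<delta>0 \<Longrightarrow> omega_limit X f y \<inter> ?U \<noteq> {}"
      using lsc unfolding lsc_at_def by meson
    \<comment> \<open>One accuracy serves twice: \<open>\<delta>0\<close> keeps the shadowing point
      where lower semicontinuity applies, \<open>e/2\<close> keeps its orbit near that of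
      \<open>v\<close>.\<close>
    have "min \<delta>0 (e/2) > 0" using \<delta>0 e by simp
    then obtain \<delta> where \<delta>: "\<delta> > 0" and shd: "\<And>s. pseudo_orbit X f \<delta> s \<Longrightarrow> s 0 = x \<Longrightarrow>
        \<exists>y\<in>X. shadowed_by f (min \<delta>0 (e/2)) s y"
      using sh unfolding shadowable_at_def by meson
    obtain n t where t: "chain X f \<delta> n t" "t 0 = x" "t n = v"
      using reach \<delta> unfolding chain_reachable_def by blast
    have v: "v \<in> X" using t by (auto simp: chain_def)
    define s where "s i = (if i < n then t i else (f ^^ (i - n)) v)" for i
    have "dist (f (s i)) (s (Suc i)) \<le> \<delta>" for i
    proof (cases "Suc i \<le> n")
      case True
      then have "s i = t i" "s (Suc i) = t (Suc i)"
        using t(3) by (auto simp: s_def)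
      then show ?thesis using t(1) True by (simp add: chain_def)
    next
      case False
      then show ?thesis using \<delta> by (simp add: s_def Suc_diff_le)
    qed
    moreover have "s i \<in> X" for i
      using t(1) iterate_in[OF v] by (auto simp: s_def chain_def)
    ultimately have "pseudo_orbit X f \<delta> s" by (simp add: pseudo_orbit_def)
    moreover have s0: "s 0 = x" using t by (auto simp: s_def)
    ultimately obtain y where y: "y \<in> X" "\<And>i. dist (s i) ((f ^^ i) y) \<le> min \<delta>0 (e/2)"
      using shd[of s] by (auto simp: shadowed_by_def)
    have "dist x y \<le> \<delta>0" using y(2)[of 0] s0 by simp
    then obtain q where q: "q \<in> omega_limit X f y" "dist p q < e/2"
      using low y(1) by fastforce
    \<comment> \<open>By time \<open>N + n\<close> the chain is over and the orbit of
      \<open>v\<close> has run for \<open>N\<close> steps; the distance bound is what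
      \<open>dist p q\<close> leaves of \<open>e/2\<close>.\<close>
    then obtain m where m: "m \<ge> N + n" "dist ((f ^^ m) y) q < e/2 - dist p q"
      unfolding omega_limit_iff by (meson diff_gt_0_iff_gt)
    have "dist ((f ^^ (m - n)) v) p \<le> dist (s m) ((f ^^ m) y) + dist ((f ^^ m) y) q + dist q p"
      using m(1) dist_triangle[of "s m" p "(f ^^ m) y"] dist_triangle[of "(f ^^ m) y" p q]
      by (simp add: s_def)
    also have "\<dots> < e" using y(2)[of m] m(2) by (simp add: dist_commute)
    finally show ?thesis using m(1) by (intro exI[of _ "m - n"]) auto
  qed
  then show "p \<in> omega_limit X f v" using pX by (simp add: omega_limit_iff)
qed

section \<open>Recurrence under powers and shadowed loops\<close>

text \<open>Infinitely many return times lie in one residue class modulo \<open>L\<close>; composing \<open>L\<close>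
  such returns gives a return time divisible by \<open>L\<close>.\<close>

lemma recurrent_power:
  assumes z: "z \<in> omega_limit X f z" and L: "L > 0" and e: "e > 0"
  shows "\<exists>k>0. dist ((f ^^ (L * k)) z) z < e"
proof -
  have zX: "z \<in> X" using z by (simp add: omega_limit_iff)
  obtain i :: "nat \<Rightarrow> nat" where i: "strict_mono i" and lim: "(\<lambda>j. (f ^^ i j) z) \<longlonglongrightarrow> z"
    using z by (auto simp: omega_limit_def)
  have "finite (range (\<lambda>j. i j mod L))"
    by (rule finite_subset[of _ "{..<L}"]) (use L in auto)
  then obtain j0 where inf: "infinite {j \<in> UNIV. i j mod L = i j0 mod L}"
    using pigeonhole_infinite[of UNIV "\<lambda>j. i j mod L"] by auto
  define r where "r = i j0 mod L"
  \<comment> \<open>Composing \<open>k\<close> returns of residue \<open>r\<close> gives residue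
    \<open>k * r\<close>; the case \<open>k = L\<close> yields a multiple of
    \<open>L\<close>.\<close>
  have "\<exists>n>0. n mod L = (k * r) mod L \<and> dist ((f ^^ n) z) z < e" if "k > 0" "e > 0" for k and e :: real
    using that
  proof (induction k arbitrary: e rule: nat_induct_non_zero)
    case 1
    obtain J where J: "\<And>j. j \<ge> J \<Longrightarrow> dist ((f ^^ i j) z) z < e"
      using lim 1 by (auto simp: lim_sequentially)
    obtain j where j: "j > J" "i j mod L = r"
      using inf unfolding infinite_nat_iff_unbounded r_def by auto
    then have "i j > 0" using seq_suble[OF i, of j] by linarith
    then show ?case using j J[of j] by (intro exI[of _ "i j"]) (auto simp: r_def)
  next
    case (Suc k)
    obtain m where m: "m > 0" "m mod L = (k * r) mod L" "dist ((f ^^ m) z) z < e/2"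
      using Suc.IH[of "e/2"] Suc.prems by auto
    \<comment> \<open>The new return is run before the \<open>m\<close> old steps, so continuity of
      \<open>f ^^ m\<close> dictates how close to \<open>z\<close> it must come.\<close>
    obtain d where d: "d > 0" "\<And>y. y \<in> X \<Longrightarrow> dist y z < d \<Longrightarrow> dist ((f ^^ m) y) ((f ^^ m) z) < e/2"
      using iterate_cont[of m] zX Suc.prems unfolding continuous_on_iff by (metis half_gt_zero)
    obtain J where J: "\<And>j. j \<ge> J \<Longrightarrow> dist ((f ^^ i j) z) z < d"
      using lim d(1) by (auto simp: lim_sequentially)
    obtain j where j: "j > J" "i j mod L = r"
      using inf unfolding infinite_nat_iff_unbounded r_def by auto
    have "dist ((f ^^ m) ((f ^^ i j) z)) ((f ^^ m) z) < e/2"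
      using J[of j] j(1) by (intro d(2) iterate_in zX) auto
    then have "dist ((f ^^ (m + i j)) z) z < e"
      using m(3) dist_triangle_half_r[of "(f ^^ m) z" "(f ^^ (m + i j)) z" e z]
      by (simp add: funpow_add dist_commute)
    moreover have "(m + i j) mod L = (Suc k * r) mod L"
      using m(2) j(2) by (metis add.commute mod_add_eq mult_Suc mod_mod_trivial)
    ultimately show ?case using m(1) by (intro exI[of _ "m + i j"]) auto
  qed
  from this[OF L e] obtain n where n: "n > 0" "n mod L = 0" "dist ((f ^^ n) z) z < e"
    by auto
  then obtain k where "n = L * k" by (auto simp: mod_eq_0_iff_dvd)
  then show ?thesis using n by (intro exI[of _ k]) auto
qed

text \<open>The two loops play the roles of \<open>BA\<close> and \<open>AB\<close>: \<open>P\<close> is inserted at the block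
  indices \<open>2 ^ j\<close>, and \<open>Q\<close> is used everywhere else.\<close>

lemma shadowed_loops_close:
  assumes recurrent: "\<And>y z. y \<in> X \<Longrightarrow> z \<in> omega_limit X f y \<Longrightarrow> z \<in> omega_limit X f z"
    and shadow: "\<And>s. pseudo_orbit X f \<delta> s \<Longrightarrow> s 0 = u \<Longrightarrow> \<exists>y\<in>X. shadowed_by f \<epsilon> s y"
    and \<epsilon>: "\<epsilon> > 0"
    and P: "chain X f \<delta> L P" "P 0 = u" "P L = u"
    and Q: "chain X f \<delta> L Q" "Q 0 = u" "Q L = u"
    and a: "a < L"
  shows "dist (P a) (Q a) < 3 * \<epsilon>"
proof -
  have L: "L > 0" using a by simp
  define g where "g k = (if \<exists>j. k = 2 ^ j then P else Q)" for k :: nat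
  define s where "s n = g (n div L) (n mod L)" for n
  have "pseudo_orbit X f \<delta> s" unfolding s_def
    by (rule pseudo_orbit_loops[OF L, where u = u]) (use P Q in \<open>auto simp: g_def\<close>)
  moreover have "s 0 = u" using P(2) Q(2) by (simp add: s_def g_def)
  ultimately obtain y where y: "y \<in> X" and shd: "\<And>i. dist (s i) ((f ^^ i) y) \<le> \<epsilon>"
    using shadow[of s] by (auto simp: shadowed_by_def)
  have s_block: "s (L * k + a) = g k a" for k
    using a by (simp add: s_def)
  \<comment> \<open>\<open>z\<close> is an accumulation point of the shadowing orbit at the starting
    times of the \<open>P\<close> blocks.\<close>
  obtain z r where z: "z \<in> X" and r: "strict_mono (r :: nat \<Rightarrow> nat)"
    and lim: "(\<lambda>j. (f ^^ (L * 2 ^ r j)) y) \<longlonglongrightarrow> z"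
    by (rule convergent_subsequence[of "\<lambda>j. (f ^^ (L * 2 ^ j)) y"]) (use iterate_in[OF y] in auto)
  have "strict_mono (\<lambda>j. L * 2 ^ r j)"
    using r L by (auto simp: strict_mono_def)
  with lim z have "z \<in> omega_limit X f y"
    unfolding omega_limit_def by (intro CollectI conjI exI[of _ "\<lambda>j. L * 2 ^ r j"]) auto
  then have rec: "z \<in> omega_limit X f z" using recurrent y by blast
  have lim_it: "(\<lambda>j. (f ^^ (n + L * 2 ^ r j)) y) \<longlonglongrightarrow> (f ^^ n) z" for n
  proof -
    have "(\<lambda>j. (f ^^ n) ((f ^^ (L * 2 ^ r j)) y)) \<longlonglongrightarrow> (f ^^ n) z"
      by (rule continuous_on_tendsto_compose[OF iterate_cont lim z])
         (simp add: iterate_in y)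
    then show ?thesis by (simp add: funpow_add)
  qed
  have close_P: "dist (P a) ((f ^^ a) z) \<le> \<epsilon>"
  proof (rule tendsto_upperbound)
    show "(\<lambda>j. dist (P a) ((f ^^ (a + L * 2 ^ r j)) y)) \<longlonglongrightarrow> dist (P a) ((f ^^ a) z)"
      by (intro tendsto_intros lim_it)
    have "dist (P a) ((f ^^ (a + L * 2 ^ r j)) y) \<le> \<epsilon>" for j
      using s_block[of "2 ^ r j"] shd[of "a + L * 2 ^ r j"] by (auto simp: g_def add.commute)
    then show "\<forall>\<^sub>F j in sequentially. dist (P a) ((f ^^ (a + L * 2 ^ r j)) y) \<le> \<epsilon>"
      by simp
  qed simp
  \<comment> \<open>Once the gaps between powers of two exceed \<open>k\<close>, the block
    \<open>k\<close> places after a \<open>P\<close> block is a \<open>Q\<close> block.\<close>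
  have close_Q: "dist (Q a) ((f ^^ (a + L * k)) z) \<le> \<epsilon>" if "k > 0" for k
  proof (rule tendsto_upperbound)
    show "(\<lambda>j. dist (Q a) ((f ^^ (a + L * k + L * 2 ^ r j)) y))
            \<longlonglongrightarrow> dist (Q a) ((f ^^ (a + L * k)) z)"
      by (intro tendsto_intros lim_it)
    have "dist (Q a) ((f ^^ (a + L * k + L * 2 ^ r j)) y) \<le> \<epsilon>" if "j \<ge> k" for j
    proof -
      have "k < 2 ^ r j"
        using that seq_suble[OF r, of j] less_exp[of "r j"] by linarith
      then have "g (2 ^ r j + k) = Q"
        using power_of_two_plus_neq[OF \<open>k > 0\<close>] by (auto simp: g_def)
      then show ?thesis
        using s_block[of "2 ^ r j + k"] shd[of "a + L * k + L * 2 ^ r j"]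
        by (simp add: algebra_simps)
    qed
    then show "\<forall>\<^sub>F j in sequentially. dist (Q a) ((f ^^ (a + L * k + L * 2 ^ r j)) y) \<le> \<epsilon>"
      unfolding eventually_sequentially by blast
  qed simp
  \<comment> \<open>Recurrence under \<open>f ^^ L\<close> brings a later block start back near
    \<open>z\<close>. Thus \<open>P a\<close> and \<open>Q a\<close> are compared through the images
    under \<open>f ^^ a\<close> of two nearby points, at the cost of three errors
    \<open>\<epsilon>\<close>.\<close>
  obtain d where d: "d > 0" "\<And>y. y \<in> X \<Longrightarrow> dist y z < d \<Longrightarrow> dist ((f ^^ a) y) ((f ^^ a) z) < \<epsilon>"
    using iterate_cont[of a] z \<epsilon> unfolding continuous_on_iff by metis
  obtain k where k: "k > 0" "dist ((f ^^ (L * k)) z) z < d"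
    using recurrent_power[OF rec L d(1)] by blast
  have "dist ((f ^^ (a + L * k)) z) ((f ^^ a) z) < \<epsilon>"
    using d(2)[OF iterate_in[OF z] k(2)] by (simp add: funpow_add)
  then show ?thesis
    using close_P close_Q[OF k(1)]
      dist_triangle[of "P a" "Q a" "(f ^^ a) z"]
      dist_triangle[of "(f ^^ a) z" "Q a" "(f ^^ (a + L * k)) z"]
    by (simp add: dist_commute)
qed

section \<open>Chain continuity at recurrent points\<close>

text \<open>The orbit of \<open>v\<close> is followed until it comes close to \<open>u\<close> and
  is then redirected there. The bound \<open>m\<close> keeps the chain on the true orbit up to a
  prescribed time.\<close>

lemma chain_from_orbit:
  assumes u: "u \<in> omega_limit X f v" and v: "v \<in> X" and \<delta>: "\<delta> > 0"
  obtains b t where "b > m" "chain X f \<delta> b t" "\<And>i. i < b \<Longrightarrow> t i = (f ^^ i) v" "t b = u"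
proof -
  obtain b where b: "b \<ge> Suc m" "dist ((f ^^ b) v) u < \<delta>"
    using u \<delta> by (auto simp only: omega_limit_iff)
  have "chain X f (0 + \<delta>) b ((\<lambda>i. (f ^^ i) v)(b := u))"
    using b u v
    by (intro chain_move_end pseudo_orbit_imp_chain orbit_pseudo_orbit) (auto simp: omega_limit_iff)
  then show thesis using b by (intro that[of b "(\<lambda>i. (f ^^ i) v)(b := u)"]) auto
qed

lemma chain_continuous_at_recurrent:
  assumes recurrent: "\<And>y z. y \<in> X \<Longrightarrow> z \<in> omega_limit X f y \<Longrightarrow> z \<in> omega_limit X f z"
    and u: "u \<in> omega_limit X f u"
    and reach: "\<And>v. chain_reachable X f u v \<Longrightarrow> u \<in> omega_limit X f v"
    and sh: "shadowable_at X f u"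
  shows "chain_continuous_at X f u"
proof (rule ccontr)
  have uX: "u \<in> X" using u by (simp add: omega_limit_iff)
  assume "\<not> chain_continuous_at X f u"
  then obtain \<epsilon> where \<epsilon>: "\<epsilon> > 0"
    and bad: "\<And>\<delta>. \<delta> > 0 \<Longrightarrow> \<exists>s i. pseudo_orbit X f \<delta> s \<and> s 0 = u \<and> dist (s i) ((f ^^ i) u) > \<epsilon>"
    unfolding chain_continuous_at_def by (meson not_le)
  have "\<forall>n. \<exists>s i. pseudo_orbit X f (1 / real (Suc n)) s \<and> s 0 = u \<and> dist (s i) ((f ^^ i) u) > \<epsilon>"
    using bad by simp
  then obtain s i where s: "\<And>n. pseudo_orbit X f (1 / real (Suc n)) (s n)" "\<And>n. s n 0 = u"
    and far: "\<And>n. dist (s n (i n)) ((f ^^ i n) u) > \<epsilon>"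
    by metis
  \<comment> \<open>Compactness provides a single endpoint \<open>v\<close> for chains of every
    accuracy, although their lengths still vary.\<close>
  obtain v r where v: "v \<in> X" and r: "strict_mono (r :: nat \<Rightarrow> nat)"
    and lim: "(\<lambda>n. s (r n) (i (r n))) \<longlonglongrightarrow> v"
    by (rule convergent_subsequence[of "\<lambda>n. s n (i n)"]) (use s(1) in \<open>auto simp: pseudo_orbit_def\<close>)
  have split: "\<exists>a t. chain X f \<delta> a t \<and> t 0 = u \<and> t a = v \<and> dist v ((f ^^ a) u) > \<epsilon> / 2"
    if \<delta>: "\<delta> > 0" for \<delta>
  proof -
    \<comment> \<open>Half of \<open>\<delta>\<close> pays for the error of the pseudo orbit, half
      for moving its end to \<open>v\<close>; \<open>\<epsilon> / 2\<close> keeps \<open>v\<close>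
      away from the orbit of \<open>u\<close>.\<close>
    define \<eta> where "\<eta> = min (\<delta> / 2) (\<epsilon> / 2)"
    have \<eta>: "\<eta> > 0" using \<delta> \<epsilon> by (simp add: \<eta>_def)
    obtain J where J: "\<And>j. j \<ge> J \<Longrightarrow> dist (s (r j) (i (r j))) v < \<eta>"
      using lim \<eta> by (auto simp: lim_sequentially)
    obtain K where K: "1 / real (Suc K) < \<eta>" using \<eta> by (meson nat_approx_posE)
    define n where "n = r (max J K)"
    have "K \<le> n" using seq_suble[OF r, of "max J K"] by (simp add: n_def)
    then have "1 / real (Suc n) \<le> 1 / real (Suc K)" by (simp add: field_simps)
    then have po: "chain X f \<eta> (i n) (s n)"
      using K by (intro pseudo_orbit_imp_chain pseudo_orbit_mono[OF s(1)]) linarith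
    have near: "dist (s n (i n)) v < \<eta>" using J[of "max J K"] by (simp add: n_def)
    have pos: "i n > 0"
      using far[of n] s(2)[of n] \<epsilon> by (cases "i n = 0") auto
    have "chain X f (\<eta> + \<eta>) (i n) ((s n)(i n := v))"
      using near by (intro chain_move_end po v pos) simp
    then have "chain X f \<delta> (i n) ((s n)(i n := v))"
      by (rule chain_mono) (auto simp: \<eta>_def)
    moreover have "dist v ((f ^^ i n) u) > \<epsilon> / 2"
      using far[of n] near dist_triangle[of "s n (i n)" "(f ^^ i n) u" v] by (auto simp: \<eta>_def)
    ultimately show ?thesis
      using pos s(2)[of n]
      by (intro exI[of _ "i n"] exI[of _ "(s n)(i n := v)"]) auto
  qed
  then have "chain_reachable X f u v" unfolding chain_reachable_def by meson
  then have uv: "u \<in> omega_limit X f v" by (rule reach)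
  \<comment> \<open>Three errors \<open>\<epsilon> / 6\<close> add up to the separation
    \<open>\<epsilon> / 2\<close> from \<open>split\<close>.\<close>
  obtain \<delta> where \<delta>: "\<delta> > 0"
    and shadow: "\<And>s. pseudo_orbit X f \<delta> s \<Longrightarrow> s 0 = u \<Longrightarrow> \<exists>y\<in>X. shadowed_by f (\<epsilon> / 6) s y"
    using sh[unfolded shadowable_at_def, rule_format, of "\<epsilon> / 6"] \<epsilon> by auto
  obtain a t where t: "chain X f \<delta> a t" "t 0 = u" "t a = v"
    and vw: "dist v ((f ^^ a) u) > \<epsilon> / 2"
    using split[OF \<delta>] by blast
  obtain b t' where t': "b > 0" "chain X f \<delta> b t'" "\<And>i. i < b \<Longrightarrow> t' i = (f ^^ i) v" "t' b = u"
    using chain_from_orbit[OF uv v \<delta>, of 0] by blast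
  \<comment> \<open>Since \<open>c > a\<close>, this loop passes through \<open>(f ^^ a) u\<close>
    at time \<open>a\<close>, just when the other one passes through \<open>v\<close>.\<close>
  obtain c A where A: "c > a" "chain X f \<delta> c A" "\<And>i. i < c \<Longrightarrow> A i = (f ^^ i) u" "A c = u"
    using chain_from_orbit[OF u uX \<delta>, of a] by blast
  have "t a = t' 0" using t(3) t'(1,3) by simp
  then obtain B where B: "chain X f \<delta> (a + b) B" "\<And>i. i \<le> a \<Longrightarrow> B i = t i" "\<And>i. B (a + i) = t' i"
    using chain_append[OF t(1) t'(2)] by metis
  have A0: "A 0 = u" and Aa: "A a = (f ^^ a) u" using A(1,3) by auto
  have B0: "B 0 = u" and Ba: "B a = v" and Bend: "B (a + b) = u"
    using B(2,3) t t'(4) by auto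
  \<comment> \<open>\<open>P\<close> is \<open>B\<close> followed by \<open>A\<close>, and
    \<open>Q\<close> is \<open>A\<close> followed by \<open>B\<close>: equal lengths, but at offset
    \<open>a\<close> they are far apart.\<close>
  obtain P where P: "chain X f \<delta> (a + b + c) P" "\<And>i. i \<le> a + b \<Longrightarrow> P i = B i" "\<And>i. P (a + b + i) = A i"
    using chain_append[OF B(1) A(2)] Bend A0 by metis
  obtain Q where Q: "chain X f \<delta> (c + (a + b)) Q" "\<And>i. i \<le> c \<Longrightarrow> Q i = A i" "\<And>i. Q (c + i) = B i"
    using chain_append[OF A(2) B(1)] A(4) B0 by metis
  have "dist (P a) (Q a) < 3 * (\<epsilon> / 6)"
  proof (rule shadowed_loops_close[OF recurrent shadow])
    show "chain X f \<delta> (a + b + c) P" "chain X f \<delta> (a + b + c) Q"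
      using P(1) Q(1) by (simp_all add: add.commute)
    show "P 0 = u" "Q 0 = u" using P(2) Q(2) A0 B0 by auto
    show "P (a + b + c) = u" using P(3) A(4) by simp
    show "Q (a + b + c) = u" using Q(3)[of "a + b"] Bend by (simp add: add.commute)
    show "a < a + b + c" "\<epsilon> / 6 > 0" using A(1) \<epsilon> by auto
  qed
  moreover have "P a = v" "Q a = (f ^^ a) u"
    using P(2)[of a] Q(2)[of a] Ba Aa A(1) by auto
  ultimately show False using vw by simp
qed

section \<open>Propagation of chain continuity\<close>

text \<open>Over finitely many steps, continuity alone controls the accumulated errors.\<close>

lemma chain_tracks_orbit:
  assumes x: "x \<in> X" and \<epsilon>: "\<epsilon> > 0"
  shows "\<exists>\<delta>>0. \<forall>s. pseudo_orbit X f \<delta> s \<and> s 0 = x \<longrightarrow> (\<forall>i\<le>n. dist (s i) ((f ^^ i) x) \<le> \<epsilon>)"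
  using \<epsilon>
proof (induction n arbitrary: \<epsilon>)
  case 0
  then show ?case by (intro exI[of _ 1]) auto
next
  case (Suc n)
  obtain d where d: "d > 0"
    "\<And>y. y \<in> X \<Longrightarrow> dist y ((f ^^ n) x) < d \<Longrightarrow> dist (f y) (f ((f ^^ n) x)) < \<epsilon> / 2"
    using cont iterate_in[OF x, of n] Suc.prems unfolding continuous_on_iff by (metis half_gt_zero)
  have "min \<epsilon> (d / 2) > 0" using d(1) Suc.prems by simp
  then obtain \<delta> where \<delta>: "\<delta> > 0" and track: "\<And>s i. pseudo_orbit X f \<delta> s \<Longrightarrow> s 0 = x \<Longrightarrow> i \<le> n \<Longrightarrow>
      dist (s i) ((f ^^ i) x) \<le> min \<epsilon> (d / 2)"
    using Suc.IH by meson
  have "dist (s i) ((f ^^ i) x) \<le> \<epsilon>"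
    if s: "pseudo_orbit X f (min \<delta> (\<epsilon> / 2)) s" "s 0 = x" and i: "i \<le> Suc n" for s i
  proof -
    have s': "pseudo_orbit X f \<delta> s" by (rule pseudo_orbit_mono[OF s(1)]) simp
    show ?thesis
    proof (cases "i = Suc n")
      case False
      then show ?thesis using track[OF s' s(2), of i] i by simp
    next
      case True
      have "dist (f (s n)) (f ((f ^^ n) x)) < \<epsilon> / 2"
        using track[OF s' s(2), of n] d(1) s(1) by (intro d(2)) (auto simp: pseudo_orbit_def)
      moreover have "dist (f (s n)) (s (Suc n)) \<le> \<epsilon> / 2"
        using s(1) by (auto simp: pseudo_orbit_def)
      ultimately show ?thesis
        using True dist_triangle[of "s (Suc n)" "f ((f ^^ n) x)" "f (s n)"]
        by (simp add: dist_commute)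
    qed
  qed
  then show ?case using \<delta> Suc.prems by (intro exI[of _ "min \<delta> (\<epsilon> / 2)"]) auto
qed

text \<open>Replacing a nearby initial point by \<open>u\<close> alters only the first error, which
  continuity of \<open>f\<close> at \<open>u\<close> controls.\<close>

lemma chain_continuous_near:
  assumes u: "u \<in> X" and cc: "chain_continuous_at X f u" and \<epsilon>: "\<epsilon> > 0"
  obtains \<delta> d where "\<delta> > 0" "d > 0"
    "\<And>s i. pseudo_orbit X f \<delta> s \<Longrightarrow> dist (s 0) u < d \<Longrightarrow> dist (s i) ((f ^^ i) u) \<le> \<epsilon>"
proof -
  obtain \<delta> where \<delta>: "\<delta> > 0" and track: "\<And>s i. pseudo_orbit X f \<delta> s \<Longrightarrow> s 0 = u \<Longrightarrow>
      dist (s i) ((f ^^ i) u) \<le> \<epsilon>"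
    using cc \<epsilon> unfolding chain_continuous_at_def by meson
  obtain d where d: "d > 0" "\<And>y. y \<in> X \<Longrightarrow> dist y u < d \<Longrightarrow> dist (f y) (f u) < \<delta> / 2"
    using cont u \<delta> unfolding continuous_on_iff by (metis half_gt_zero)
  \<comment> \<open>The bound \<open>\<epsilon>\<close> on the starting distance covers index 0,
    where the modified sequence gives no information on \<open>s 0\<close>.\<close>
  have "dist (s i) ((f ^^ i) u) \<le> \<epsilon>"
    if s: "pseudo_orbit X f (\<delta> / 2) s" and s0: "dist (s 0) u < min d \<epsilon>" for s i
  proof (cases "i = 0")
    case True
    then show ?thesis using s0 by simp
  next
    case False
    have "dist (f u) (s (Suc 0)) \<le> \<delta>"
      using d(2)[of "s 0"] s s0 dist_triangle[of "f u" "s (Suc 0)" "f (s 0)"]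
      unfolding pseudo_orbit_def by (smt (verit) dist_commute field_sum_of_halves)
    moreover have "dist (f (s j)) (s (Suc j)) \<le> \<delta>" for j
      using s \<delta> unfolding pseudo_orbit_def by (smt (verit) field_sum_of_halves)
    ultimately have "pseudo_orbit X f \<delta> (s(0 := u))"
      using s u by (auto simp: pseudo_orbit_def)
    then show ?thesis using track[of "s(0 := u)" i] False by simp
  qed
  then show thesis using that[of "\<delta> / 2" "min d \<epsilon>"] \<delta> d(1) \<epsilon> by simp
qed

text \<open>The orbit of \<open>x\<close> comes near \<open>u\<close> after finitely many steps,
  which are tracked by continuity. From then on it and the pseudo orbit both follow the orbit of
  \<open>u\<close>.\<close>

lemma chain_continuous_at_of_omega_limit:
  assumes x: "x \<in> X" and u: "u \<in> omega_limit X f x" and cc: "chain_continuous_at X f u"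
  shows "chain_continuous_at X f x"
  unfolding chain_continuous_at_def
proof (intro allI impI)
  fix \<epsilon> :: real assume \<epsilon>: "\<epsilon> > 0"
  have uX: "u \<in> X" using u by (simp add: omega_limit_iff)
  obtain \<delta> d where \<delta>: "\<delta> > 0" and d: "d > 0" and near: "\<And>s i. pseudo_orbit X f \<delta> s \<Longrightarrow>
      dist (s 0) u < d \<Longrightarrow> dist (s i) ((f ^^ i) u) \<le> \<epsilon> / 2"
    using chain_continuous_near[OF uX cc, of "\<epsilon> / 2"] \<epsilon> by (metis half_gt_zero)
  \<comment> \<open>The other \<open>d / 2\<close> is reserved for the tracking error of the pseudo
    orbit up to time \<open>k\<close>.\<close>
  obtain k where k: "dist ((f ^^ k) x) u < d / 2"
    using u d unfolding omega_limit_iff by (meson half_gt_zero)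
  have "min \<epsilon> (d / 2) > 0" using \<epsilon> d by simp
  from chain_tracks_orbit[OF x this, of k]
  obtain \<delta>' where \<delta>': "\<delta>' > 0" and track: "\<And>s i. pseudo_orbit X f \<delta>' s \<Longrightarrow> s 0 = x \<Longrightarrow> i \<le> k \<Longrightarrow>
      dist (s i) ((f ^^ i) x) \<le> min \<epsilon> (d / 2)"
    by meson
  have "dist (s i) ((f ^^ i) x) \<le> \<epsilon>"
    if s: "pseudo_orbit X f (min \<delta> \<delta>') s" "s 0 = x" for s i
  proof -
    have s1: "pseudo_orbit X f \<delta> s" and s2: "pseudo_orbit X f \<delta>' s"
      by (rule pseudo_orbit_mono[OF s(1)], simp)+
    show ?thesis
    proof (cases "i \<le> k")
      case True
      then show ?thesis using track[OF s2 s(2)] by simp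
    next
      case False
      then obtain j where j: "i = k + j" by (metis le_add_diff_inverse nat_le_linear)
      have "dist (s k) u < d"
        using track[OF s2 s(2), of k] k dist_triangle[of "s k" u "(f ^^ k) x"] by simp
      then have "dist (s (k + j)) ((f ^^ j) u) \<le> \<epsilon> / 2"
        using near[OF pseudo_orbit_shift[OF s1], of k j] by simp
      \<comment> \<open>The true orbit is an exact pseudo orbit, so \<open>near\<close> applies to
        it as well.\<close>
      moreover have "dist ((f ^^ j) ((f ^^ k) x)) ((f ^^ j) u) \<le> \<epsilon> / 2"
        using near[OF orbit_pseudo_orbit[OF iterate_in[OF x]], of k j] k d \<delta> by simp
      ultimately show ?thesis
        using dist_triangle2[of "s i" "(f ^^ i) x" "(f ^^ j) u"]
        by (simp add: j funpow_add add.commute[of k j])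
    qed
  qed
  then show "\<exists>\<delta>>0. \<forall>s. pseudo_orbit X f \<delta> s \<and> s 0 = x \<longrightarrow> (\<forall>i. dist (s i) ((f ^^ i) x) \<le> \<epsilon>)"
    using \<delta> \<delta>' by (intro exI[of _ "min \<delta> \<delta>'"]) auto
qed

section \<open>The two implications\<close>

lemma chain_continuous_at_of_lsc:
  assumes sh: "\<And>x. x \<in> X \<Longrightarrow> shadowable_at X f x"
    and lsc: "\<And>x. x \<in> X \<Longrightarrow> lsc_at X (omega_limit X f) x"
    and x: "x \<in> X"
  shows "chain_continuous_at X f x"
proof -
  have sub: "omega_limit X f y \<subseteq> omega_limit X f v" if "y \<in> X" "chain_reachable X f y v" for y v
    using omega_limit_subset_of_chain_reachable sh lsc that by blast
  \<comment> \<open>\<open>z\<close> is chain reachable from \<open>y\<close>, so \<open>sub\<close>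
    carries \<open>z\<close> from the limit set of \<open>y\<close> into its own.\<close>
  have recurrent: "z \<in> omega_limit X f z" if "y \<in> X" "z \<in> omega_limit X f y" for y z
    using sub chain_reachable_omega_limit that by blast
  obtain u where u: "u \<in> omega_limit X f x" using omega_limit_nonempty[OF x] by blast
  then have uX: "u \<in> X" by (simp add: omega_limit_iff)
  have uu: "u \<in> omega_limit X f u" using recurrent x u by blast
  have "chain_continuous_at X f u"
    by (rule chain_continuous_at_recurrent[OF recurrent uu _ sh[OF uX]]) (use sub uX uu in blast)+
  then show ?thesis using chain_continuous_at_of_omega_limit x u by blast
qed

lemma lsc_at_of_chain_continuous:
  assumes x: "x \<in> X" and cc: "chain_continuous_at X f x"
  shows "lsc_at X (omega_limit X f) x"
  unfolding lsc_at_def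
proof (intro allI impI, elim conjE)
  fix U assume U: "openin (top_of_set X) U" and "omega_limit X f x \<inter> U \<noteq> {}"
  then obtain z where z: "z \<in> omega_limit X f x" "z \<in> U" by blast
  obtain e where e: "e > 0" "\<And>y. y \<in> X \<Longrightarrow> dist y z < e \<Longrightarrow> y \<in> U"
    using U z(2) unfolding openin_euclidean_subtopology_iff by blast
  obtain \<delta> d where \<delta>: "\<delta> > 0" and d: "d > 0" and near: "\<And>s i. pseudo_orbit X f \<delta> s \<Longrightarrow>
      dist (s 0) x < d \<Longrightarrow> dist (s i) ((f ^^ i) x) \<le> e / 2"
    using chain_continuous_near[OF x cc, of "e / 2"] e(1) by (metis half_gt_zero)
  have "omega_limit X f y \<inter> U \<noteq> {}" if y: "y \<in> X" "dist x y \<le> d / 2" for y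
  proof -
    have "dist y x < d" using y(2) d by (simp add: dist_commute)
    then have close: "dist ((f ^^ n) y) ((f ^^ n) x) \<le> e / 2" for n
      using near[OF orbit_pseudo_orbit[OF y(1)], of n] \<delta> by simp
    obtain i :: "nat \<Rightarrow> nat" where i: "strict_mono i" and lim: "(\<lambda>j. (f ^^ i j) x) \<longlonglongrightarrow> z"
      using z(1) by (auto simp: omega_limit_def)
    \<comment> \<open>Thinning out the times along which the orbit of \<open>x\<close> tends to
      \<open>z\<close> makes the orbit of \<open>y\<close> converge along the same times.\<close>
    obtain q r where q: "q \<in> X" and r: "strict_mono (r :: nat \<Rightarrow> nat)"
      and limq: "(\<lambda>j. (f ^^ i (r j)) y) \<longlonglongrightarrow> q"
      by (rule convergent_subsequence[of "\<lambda>j. (f ^^ i j) y"]) (use iterate_in[OF y(1)] in auto)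
    have limz: "(\<lambda>j. (f ^^ i (r j)) x) \<longlonglongrightarrow> z"
      using LIMSEQ_subseq_LIMSEQ[OF lim r] by (simp add: o_def)
    have "dist q z \<le> e / 2"
      by (rule tendsto_upperbound[OF tendsto_dist[OF limq limz]]) (use close in auto)
    then have "q \<in> U" using e q by auto
    moreover have "strict_mono (\<lambda>j. i (r j))" using i r by (simp add: strict_mono_def)
    with q limq have "q \<in> omega_limit X f y"
      unfolding omega_limit_def by (intro CollectI conjI exI[of _ "\<lambda>j. i (r j)"]) auto
    ultimately show ?thesis by blast
  qed
  then show "\<exists>\<delta>>0. \<forall>y\<in>X. dist x y \<le> \<delta> \<longrightarrow> omega_limit X f y \<inter> U \<noteq> {}"
    using d by (intro exI[of _ "d / 2"]) auto
qed

end

theorem theorem5p1: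
  fixes X :: "'a::metric_space set" and f :: "'a \<Rightarrow> 'a"
  assumes "compact X"
    and "f \<in> X \<rightarrow> X"
    and "continuous_on X f"
    and "X = Sh X f"
  shows "X = LSC X (omega_limit X f) \<longleftrightarrow> X = CC X f"
proof -
  interpret compact_system X f
    using assms by unfold_locales auto
  have "shadowable_at X f x" if "x \<in> X" for x
    using assms(4) that by (auto simp: Sh_def)
  then have "(\<forall>x\<in>X. lsc_at X (omega_limit X f) x) \<longleftrightarrow> (\<forall>x\<in>X. chain_continuous_at X f x)"
    using chain_continuous_at_of_lsc lsc_at_of_chain_continuous by blast
  then show ?thesis unfolding LSC_def CC_def by blast
qed

end
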